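(* For all real numbers $s \in (0,1)$ and $p \in (0,1/2]$, the random XOR-formula $Q^{p}(n, sn)$ is with high probability $\Omega(n)$-separated; that is, there exists a function $g(n) \in \Omega(n)$ such that $\lim_{n\to\infty} \Pr[Q^{p}(n, sn) \text{ is } g(n)\text{-separated}] = 1$.
   Context: Let $X_1, \dots, X_n$ be propositional variables. An XOR-clause over $n$ variables is the exclusive-or of exactly one of the constants $0$ or $1$ together with a subset of the variables $X_1,\dots,X_n$; if it includes the constant $0$ (respectively $1$), it evaluates to true under a truth assignment if and only if an odd (respectively even) number of its included variables evaluate to true. A random XOR-clause with variable-probability $p \in [0,1]$ is obtained by including each $X_i$ independently with probability $p$, and (independently) including the constant $1$ with probability $1/2$ and the constant $0$ otherwise. For a positive integer $n$, a nonnegative real $s$, and $p\in[0,1]$, $Q^{p}(n, sn)$ denotes the random formula that is the conjunction of $\lceil sn \rceil$ independently chosen random XOR-clauses over $n$ variables with variable-probability $p$. A solution of a formula is a truth assignment to $X_1,\dots,X_n$ under which the formula evaluates to true. For a real number $d$, a formula is $d$-separated if the Hamming distance between every pair of distinct solutions is at least $d$ (vacuously true if there are fewer than two solutions). $g(n)\in\Omega(n)$ means there is a constant $c>0$ with $g(n)\ge cn$ for all sufficiently large $n$. A sequence of events $E_n$ occurs with high probability if $\Pr[E_n]\to 1$ as $n\to\infty$. *)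

theory Defs
  imports "HOL-Probability.Probability"
begin

text \<open>
  A clause \<open>(c, V)\<close> stands for the exclusive-or of the constant \<open>c\<close> (\<open>True\<close> for 1, \<open>False\<close> for 0)
  and the variables \<open>X\<^sub>i\<close> with \<open>i \<in> V\<close>. The variables are indexed by \<open>{1..n}\<close>, and a formula is the
  conjunction of the clauses in a list.
\<close>

type_synonym xor_clause = "bool \<times> nat set"

type_synonym xor_formula = "xor_clause list"

fun sat_clause :: "(nat \<Rightarrow> bool) \<Rightarrow> xor_clause \<Rightarrow> bool" where
  "sat_clause a (c, V) =
     (if c then even (card {i \<in> V. a i}) else odd (card {i \<in> V. a i}))"

definition sat_formula :: "(nat \<Rightarrow> bool) \<Rightarrow> xor_formula \<Rightarrow> bool" where
  "sat_formula a F \<longleftrightarrow> (\<forall>C \<in> set F. sat_clause a C)"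

text \<open>
  Truth assignments are extensional functions on \<open>{1..n}\<close>, so two of them are distinct iff they
  differ on some variable.
\<close>

definition solutions :: "nat \<Rightarrow> xor_formula \<Rightarrow> (nat \<Rightarrow> bool) set" where
  "solutions n F = {a \<in> {1..n} \<rightarrow>\<^sub>E UNIV. sat_formula a F}"

definition hamming :: "nat \<Rightarrow> (nat \<Rightarrow> bool) \<Rightarrow> (nat \<Rightarrow> bool) \<Rightarrow> nat" where
  "hamming n a b = card {i \<in> {1..n}. a i \<noteq> b i}"

definition separated :: "nat \<Rightarrow> real \<Rightarrow> xor_formula \<Rightarrow> bool" where
  "separated n d F \<longleftrightarrow>
     (\<forall>a \<in> solutions n F. \<forall>b \<in> solutions n F. a \<noteq> b \<longrightarrow> d \<le> real (hamming n a b))"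

definition random_clause :: "real \<Rightarrow> nat \<Rightarrow> xor_clause pmf" where
  "random_clause p n =
     pair_pmf (bernoulli_pmf (1/2))
       (map_pmf (\<lambda>f. {i \<in> {1..n}. f i}) (Pi_pmf {1..n} False (\<lambda>_. bernoulli_pmf p)))"

definition random_formula :: "real \<Rightarrow> nat \<Rightarrow> real \<Rightarrow> xor_formula pmf" where
  "random_formula p n r = replicate_pmf (nat \<lceil>r\<rceil>) (random_clause p n)"

text \<open>
  The library's \<open>\<Omega>\<close> compares norms, so it also contains functions such as \<open>\<lambda>n. - real n\<close>, for
  which separation holds trivially. Here the bound is on the value itself.
\<close>

definition Omega_linear :: "(nat \<Rightarrow> real) \<Rightarrow> bool" where
  "Omega_linear g \<longleftrightarrow> (\<exists>c>0. \<forall>\<^sub>F n in sequentially. c * real n \<le> g n)"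

end

theory Submission
  imports Defs
begin

text \<open>
  If two solutions differ exactly on \<open>D\<close>, then every clause contains an even number of variables
  from \<open>D\<close>. For a fixed nonempty \<open>D\<close> a random clause does so with probability at most \<open>1 - p\<close>:
  given the other variables, the parity is decided by the inclusion of a single element of \<open>D\<close>.
  The union bound over all \<open>D\<close> with fewer than \<open>\<epsilon> n\<close> elements then suffices, since for small
  \<open>\<epsilon>\<close> the number of these sets grows more slowly than \<open>(1 - p) powr (- s n)\<close>. Taking the union
  over differences rather than over pairs of solutions is essential, as the expected number of
  solutions is exponential.
\<close>

lemma prob_bind_pmf:
  "measure_pmf.prob (bind_pmf M f) A = (\<integral>x. measure_pmf.prob (f x) A \<partial>M)"
proof -
  have "ennreal (measure_pmf.prob (bind_pmf M f) A) = (\<integral>\<^sup>+x. ennreal (measure_pmf.prob (f x) A) \<partial>M)"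
    by (simp flip: measure_pmf.emeasure_eq_measure)
  also have "\<dots> = ennreal (\<integral>x. measure_pmf.prob (f x) A \<partial>M)"
    by (intro nn_integral_eq_integral measure_pmf.integrable_const_bound[where B = 1]) auto
  finally show ?thesis by (simp add: integral_nonneg_AE)
qed

lemma prob_replicate_pmf_all:
  "measure_pmf.prob (replicate_pmf m P) {xs. \<forall>x\<in>set xs. x \<in> A} = measure_pmf.prob P A ^ m"
proof (induction m)
  case (Suc m)
  have "measure_pmf.prob (replicate_pmf (Suc m) P) {xs. \<forall>x\<in>set xs. x \<in> A}
      = (\<integral>x. measure_pmf.prob (map_pmf (Cons x) (replicate_pmf m P))
          {xs. \<forall>x\<in>set xs. x \<in> A} \<partial>P)"
    by (simp add: prob_bind_pmf[of P] flip: map_pmf_def)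
  also have "\<dots> = (\<integral>x. indicator A x * measure_pmf.prob P A ^ m \<partial>P)"
    by (intro Bochner_Integration.integral_cong)
      (auto simp: vimage_def indicator_def Suc.IH)
  also have "\<dots> = measure_pmf.prob P A ^ Suc m"
    by simp
  finally show ?case .
qed simp

text \<open>A proper subset of the two truth values lies in a singleton, of mass \<open>p\<close> or
  \<open>1 - p\<close>; the bound \<open>p \<le> 1 / 2\<close> makes \<open>1 - p\<close> the
  larger.\<close>

lemma prob_bernoulli_le:
  assumes "0 \<le> p" "p \<le> 1 / 2" and "S \<noteq> UNIV"
  shows "measure_pmf.prob (bernoulli_pmf p) S \<le> 1 - p"
proof -
  from assms(3) obtain b where "b \<notin> S" by blast
  then have "S \<subseteq> {\<not> b}" by (cases b) (auto intro: ccontr)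
  then have "measure_pmf.prob (bernoulli_pmf p) S \<le> measure_pmf.prob (bernoulli_pmf p) {\<not> b}"
    by (intro measure_pmf.finite_measure_mono) auto
  also have "\<dots> \<le> 1 - p"
    using assms by (cases b) (auto simp: measure_pmf_single)
  finally show ?thesis .
qed

lemma prob_even_Int_le:
  assumes p: "0 \<le> p" "p \<le> 1 / 2" and D: "D \<subseteq> {1..n}" "D \<noteq> {}"
  shows "measure_pmf.prob (random_clause p n) {C. even (card (snd C \<inter> D))} \<le> 1 - p"
proof -
  obtain i where i: "i \<in> D" using D by blast
  define A where "A = {1..n} - {i}"
  have ins: "{1..n} = insert i A" "i \<notin> A" "finite A"
    using i D by (auto simp: A_def)
  define Q where "Q = Pi_pmf A False (\<lambda>_. bernoulli_pmf p)"
  define E where "E = {f. even (card ({j \<in> {1..n}. f j} \<inter> D))}"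
  have "measure_pmf.prob (random_clause p n) {C. even (card (snd C \<inter> D))}
      = measure_pmf.prob (map_pmf snd (random_clause p n)) {V. even (card (V \<inter> D))}"
    by (simp add: vimage_def)
  also have "\<dots> = measure_pmf.prob (Pi_pmf {1..n} False (\<lambda>_. bernoulli_pmf p)) E"
    unfolding random_clause_def map_snd_pair_pmf by (simp add: vimage_def E_def)
  \<comment> \<open>The bit at \<open>i\<close> is drawn last, so that the inner probability is
    conditional on all other bits \<open>f\<close>.\<close>
  also have "Pi_pmf {1..n} False (\<lambda>_. bernoulli_pmf p)
      = bind_pmf Q (\<lambda>f. map_pmf (\<lambda>y. f(i := y)) (bernoulli_pmf p))"
    unfolding ins Q_def
    by (subst Pi_pmf_insert', use ins in simp_all)
      (subst bind_commute_pmf, simp add: map_pmf_def)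
  also have "measure_pmf.prob \<dots> E
      = (\<integral>f. measure_pmf.prob (bernoulli_pmf p) {y. f(i := y) \<in> E} \<partial>Q)"
    by (simp add: prob_bind_pmf vimage_def)
  also have "\<dots> \<le> (\<integral>f. 1 - p \<partial>Q)"
  proof (intro integral_mono measure_pmf.integrable_const_bound[where B = 1] prob_bernoulli_le p)
    fix f :: "nat \<Rightarrow> bool"
    let ?W = "{j \<in> {1..n}. (f(i := False)) j} \<inter> D"
    \<comment> \<open>Since \<open>i\<close> is in \<open>D\<close>, switching its bit changes the
      count by one, so at most one value of the bit leads into \<open>E\<close>.\<close>
    have "{j \<in> {1..n}. (f(i := True)) j} \<inter> D = insert i ?W"
      using i D by auto
    then have "card ({j \<in> {1..n}. (f(i := True)) j} \<inter> D) = Suc (card ?W)"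
      by simp
    then have "\<not> (f(i := True) \<in> E \<and> f(i := False) \<in> E)"
      unfolding E_def by simp
    then show "{y. f(i := y) \<in> E} \<noteq> UNIV"
      by blast
  qed (use p in auto)
  finally show ?thesis by simp
qed

text \<open>The symmetric difference has size \<open>card ?A + card ?B\<close> minus twice the size
  of the intersection, and the shared constant \<open>c\<close> forces both cardinalities to the
  same parity.\<close>

lemma even_card_difference:
  assumes V: "finite V" and "sat_clause a (c, V)" "sat_clause b (c, V)"
  shows "even (card {i \<in> V. a i \<noteq> b i})"
proof -
  let ?A = "{i \<in> V. a i}" and ?B = "{i \<in> V. b i}"
  have "card ?A = card (?A - ?B) + card (?A \<inter> ?B)"
    using V by (subst card_Un_disjoint[symmetric]) (auto intro!: arg_cong[where f = card])
  moreover have "card ?B = card (?B - ?A) + card (?A \<inter> ?B)"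
    using V by (subst card_Un_disjoint[symmetric]) (auto intro!: arg_cong[where f = card])
  moreover have "card {i \<in> V. a i \<noteq> b i} = card (?A - ?B) + card (?B - ?A)"
    using V by (subst card_Un_disjoint[symmetric]) (auto intro!: arg_cong[where f = card])
  moreover have "even (card ?A) = even (card ?B)"
    using assms by (auto split: if_splits)
  ultimately show ?thesis by presburger
qed

lemma not_separatedE:
  assumes "\<not> separated n d F" and vars: "\<And>c V. (c, V) \<in> set F \<Longrightarrow> V \<subseteq> {1..n}"
  obtains D where "D \<subseteq> {1..n}" "D \<noteq> {}" "real (card D) < d"
    "\<forall>C\<in>set F. even (card (snd C \<inter> D))"
proof -
  obtain a b where ab: "a \<in> solutions n F" "b \<in> solutions n F" "a \<noteq> b" "real (hamming n a b) < d"
    using assms(1) unfolding separated_def by force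
  let ?D = "{i \<in> {1..n}. a i \<noteq> b i}"
  have "?D \<noteq> {}"
  proof
    assume "?D = {}"
    \<comment> \<open>Solutions are extensional, so agreement on the variables is equality.\<close>
    then have "a = b"
      using ab(1,2) by (intro PiE_ext[of a "{1..n}" "\<lambda>_. UNIV" b]) (auto simp: solutions_def)
    with ab show False by simp
  qed
  moreover have "even (card (snd C \<inter> ?D))" if C: "C \<in> set F" for C
  proof -
    obtain c V where CV: "C = (c, V)" by (cases C)
    then have "V \<subseteq> {1..n}" using C vars by blast
    then have "snd C \<inter> ?D = {i \<in> V. a i \<noteq> b i}" "finite V"
      using CV by (auto intro: finite_subset)
    moreover have "sat_clause a (c, V)" "sat_clause b (c, V)"
      using ab C CV by (auto simp: solutions_def sat_formula_def)
    ultimately show ?thesis using even_card_difference by metis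
  qed
  moreover have "?D \<subseteq> {1..n}" "real (card ?D) < d"
    using ab(4) by (auto simp: hamming_def)
  ultimately show ?thesis using that by blast
qed

lemma random_formula_vars:
  assumes "F \<in> set_pmf (random_formula p n r)" "(c, V) \<in> set F"
  shows "V \<subseteq> {1..n}"
  using assms by (fastforce simp: random_formula_def random_clause_def set_replicate_pmf)

lemma sum_Pow_power_card:
  fixes x :: "'a :: comm_semiring_1"
  assumes "finite A"
  shows "(\<Sum>D\<in>Pow A. x ^ card D) = (1 + x) ^ card A"
  using prod_add[OF assms, of "\<lambda>_. x" "\<lambda>_. 1"] by (simp add: add.commute)

text \<open>Binomial tails are avoided by a Chernoff-style weight:
  \<open>x powr (card D - e * n)\<close> is at least 1 for every relevant \<open>D\<close>, and
  summed over all subsets it has a closed form.\<close>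

lemma prob_not_separated_le:
  assumes p: "0 < p" "p \<le> 1 / 2" and x: "0 < x" "x \<le> 1"
  shows "measure_pmf.prob (random_formula p n (s * real n)) {F. \<not> separated n (e * real n) F}
    \<le> ((1 - p) powr s * (1 + x) * x powr (- e)) ^ n"
proof -
  let ?M = "random_formula p n (s * real n)"
  let ?S = "{D \<in> Pow {1..n}. D \<noteq> {} \<and> real (card D) < e * real n}"
  let ?E = "\<lambda>D. {F. \<forall>C\<in>set F. C \<in> {C. even (card (snd C \<inter> D))}}"
  let ?m = "nat \<lceil>s * real n\<rceil>"
  have "measure_pmf.prob ?M {F. \<not> separated n (e * real n) F}
      \<le> measure_pmf.prob ?M (\<Union>D\<in>?S. ?E D)"
  \<comment> \<open>The inclusion is needed only on the support, where all clauses use variables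
    from \<open>{1..n}\<close>.\<close>
  proof (rule measure_pmf.finite_measure_mono_AE)
    show "AE F in ?M. F \<in> {F. \<not> separated n (e * real n) F} \<longrightarrow> F \<in> (\<Union>D\<in>?S. ?E D)"
    proof (rule AE_pmfI, rule impI)
      fix F assume F: "F \<in> set_pmf ?M" "F \<in> {F. \<not> separated n (e * real n) F}"
      from F(2) have "\<not> separated n (e * real n) F" by simp
      then show "F \<in> (\<Union>D\<in>?S. ?E D)"
      proof (rule not_separatedE)
        show "V \<subseteq> {1..n}" if "(c, V) \<in> set F" for c V
          using random_formula_vars[OF F(1) that] .
      qed auto
    qed
  qed simp
  also have "\<dots> \<le> (\<Sum>D\<in>?S. measure_pmf.prob ?M (?E D))"
    by (rule measure_pmf.finite_measure_subadditive_finite) auto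
  also have "\<dots> \<le> (\<Sum>D\<in>?S. (1 - p) powr (s * n) * (x ^ card D * x powr (- e * n)))"
  proof (rule sum_mono)
    fix D assume D: "D \<in> ?S"
    have "measure_pmf.prob ?M (?E D) \<le> (1 - p) ^ ?m"
      unfolding random_formula_def prob_replicate_pmf_all
      using p D by (intro power_mono prob_even_Int_le) auto
    also have "\<dots> = (1 - p) powr real ?m"
      using p by (simp add: powr_realpow)
    \<comment> \<open>Rounding the number of clauses up only lowers the bound, as the base is below
      1.\<close>
    also have "\<dots> \<le> (1 - p) powr (s * n)"
      using p by (intro powr_mono') linarith+
    also have "\<dots> \<le> (1 - p) powr (s * n) * (x ^ card D * x powr (- e * n))"
    proof -
      have "x powr 0 \<le> x powr (real (card D) + - e * n)"
        using D x by (intro powr_mono') auto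
      then have "1 \<le> x ^ card D * x powr (- e * n)"
        unfolding powr_add using x by (simp add: powr_realpow)
      then show ?thesis
        by (intro mult_left_le[THEN order_trans] mult_le_cancel_left1[THEN iffD2]) auto
    qed
    finally show "measure_pmf.prob ?M (?E D)
      \<le> (1 - p) powr (s * n) * (x ^ card D * x powr (- e * n))" .
  qed
  also have "\<dots> \<le> (\<Sum>D\<in>Pow {1..n}. (1 - p) powr (s * n) * (x ^ card D * x powr (- e * n)))"
    using x by (intro sum_mono2) auto
  also have "\<dots> = (1 - p) powr (s * n) * ((1 + x) ^ n * x powr (- e * n))"
    using sum_Pow_power_card[of "{1..n}" x]
    by (simp flip: sum_distrib_left sum_distrib_right)
  also have "\<dots> = ((1 - p) powr s * (1 + x) * x powr (- e)) ^ n"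
    using p x by (simp add: power_mult_distrib powr_power mult.commute mult.left_commute)
  finally show ?thesis .
qed

text \<open>First \<open>x\<close> is fixed so small that \<open>q * (1 + x)\<close> stays below 1;
  then \<open>e\<close> is taken small enough that \<open>x powr (- e)\<close> uses up only part of
  the remaining gap.\<close>

lemma exists_entropy_constants:
  fixes q :: real
  assumes "0 < q" "q < 1"
  obtains x e where "0 < x" "x \<le> 1" "0 < e" "q * (1 + x) * x powr (- e) < 1"
proof -
  define x where "x = (1 - q) / 2"
  define r where "r = q * (1 + x)"
  have x: "0 < x" "x < 1" using assms by (auto simp: x_def)
  \<comment> \<open>This product equals \<open>2 * (1 - r)\<close>.\<close>
  have "0 < (1 - q) * (2 - q)" using assms by simp
  then have r: "0 < r" "r < 1"
    using assms x by (auto simp: r_def x_def field_simps)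
  \<comment> \<open>Chosen so that \<open>x powr (- e)\<close> is the inverse square root of
    \<open>r\<close>; both logarithms are negative.\<close>
  define e where "e = ln r / (2 * ln x)"
  have "0 < e" using x r by (simp add: e_def zero_less_divide_iff)
  moreover have "r * x powr (- e) < 1"
  proof -
    have "r * x powr (- e) = exp (ln r) * exp (- ln r / 2)"
      using x r by (simp add: powr_def e_def)
    also have "\<dots> = exp (ln r / 2)" by (simp flip: exp_add)
    also have "\<dots> < 1" using r by simp
    finally show ?thesis .
  qed
  ultimately show ?thesis using x that[of x e] by (simp add: r_def)
qed

theorem corollary3:
  fixes s p :: real
  assumes "0 < s" "s < 1" and "0 < p" "p \<le> 1 / 2"
  shows "\<exists>g :: nat \<Rightarrow> real. Omega_linear g \<and>
    (\<lambda>n. measure_pmf.prob (random_formula p n (s * real n)) {F. separated n (g n) F})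
      \<longlonglongrightarrow> 1"
proof -
  have "0 < (1 - p) powr s" "(1 - p) powr s < 1"
    using assms powr_less_mono'[of "1 - p" 0 s] by auto
  then obtain x e where xe: "0 < x" "x \<le> 1" "0 < e" "(1 - p) powr s * (1 + x) * x powr (- e) < 1"
    by (rule exists_entropy_constants)
  \<comment> \<open>The probability of failure is at most \<open>t ^ n\<close>, hence decays
    exponentially.\<close>
  define t where "t = (1 - p) powr s * (1 + x) * x powr (- e)"
  have t: "0 \<le> t" "t < 1" using xe by (auto simp: t_def)
  let ?P = "\<lambda>n. measure_pmf.prob (random_formula p n (s * real n))"
  have "?P n {F. separated n (e * real n) F} = 1 - ?P n {F. \<not> separated n (e * real n) F}" for n
    by (subst measure_pmf.prob_compl[symmetric]) (auto intro!: arg_cong2[where f = measure])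
  then have lower: "1 - t ^ n \<le> ?P n {F. separated n (e * real n) F}" for n
    using prob_not_separated_le[of p x n s e] assms xe by (simp add: t_def)
  have "(\<lambda>n. 1 - t ^ n) \<longlonglongrightarrow> 1"
    using tendsto_diff[OF tendsto_const LIMSEQ_power_zero, of t 1] t by simp
  then have "(\<lambda>n. ?P n {F. separated n (e * real n) F}) \<longlonglongrightarrow> 1"
    by (rule real_tendsto_sandwich[OF _ _ _ tendsto_const, rotated 2]) (use lower in simp_all)
  moreover have "Omega_linear (\<lambda>n. e * real n)"
    using xe by (auto simp: Omega_linear_def)
  ultimately show ?thesis by blast
qed

end
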